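(* For every positive integer $n$, the following statistics on $S_n$ are homomesic with respect to the Kreweras complement $\mathcal{K}$ and with respect to its inverse $\mathcal{K}^{-1}$: (1) the number of exceedances; (2) the number of weak deficiencies; (3) the last entry $\sigma_n$; (4) when $n$ is even, the entry $\sigma_{n/2}$.
   Context: A statistic $f$ is homomesic with respect to a bijection $\mathcal{X}$ of a finite set if there is a constant $c$ such that its average over every orbit of $\mathcal{X}$ equals $c$. Permutations are in one-line notation and composed right to left. Let $c\in S_n$ be the long cycle $c=234\cdots n1$ (i.e. $c(i)=i+1$ for $i<n$, $c(n)=1$). The Kreweras complement is $\mathcal{K}(\sigma)=c\circ\sigma^{-1}$, with inverse $\mathcal{K}^{-1}(\sigma)=\sigma^{-1}\circ c$. An index $i$ is an exceedance of $\sigma$ if $\sigma_i>i$ and a weak deficiency if $\sigma_i\le i$. *)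

theory Defs
  imports Complex_Main "HOL-Combinatorics.Permutations" "HOL-Combinatorics.Orbits"
begin

text \<open>
  A permutation in \<open>S\<^sub>n\<close> is a function \<open>\<sigma>\<close> with \<open>\<sigma> permutes {1..n}\<close>, so it fixes every number
  outside \<open>{1..n}\<close>; the entry \<open>\<sigma>\<^sub>i\<close> of its one-line notation is \<open>\<sigma> i\<close>.
\<close>

definition sym_group :: "nat \<Rightarrow> (nat \<Rightarrow> nat) set" where
  "sym_group n = {\<sigma>. \<sigma> permutes {1..n}}"

definition long_cycle :: "nat \<Rightarrow> nat \<Rightarrow> nat" where
  "long_cycle n i = (if 1 \<le> i \<and> i < n then i + 1 else if i = n then 1 else i)"

definition kreweras :: "nat \<Rightarrow> (nat \<Rightarrow> nat) \<Rightarrow> (nat \<Rightarrow> nat)" where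
  "kreweras n \<sigma> = long_cycle n \<circ> inv \<sigma>"

definition kreweras_inv :: "nat \<Rightarrow> (nat \<Rightarrow> nat) \<Rightarrow> (nat \<Rightarrow> nat)" where
  "kreweras_inv n \<sigma> = inv \<sigma> \<circ> long_cycle n"

definition exceedances :: "nat \<Rightarrow> (nat \<Rightarrow> nat) \<Rightarrow> nat set" where
  "exceedances n \<sigma> = {i \<in> {1..n}. \<sigma> i > i}"

definition weak_deficiencies :: "nat \<Rightarrow> (nat \<Rightarrow> nat) \<Rightarrow> nat set" where
  "weak_deficiencies n \<sigma> = {i \<in> {1..n}. \<sigma> i \<le> i}"

text \<open>
  The library's \<open>orbit T x\<close> consists of the iterates \<open>(T ^^ k) x\<close> with \<open>k > 0\<close>; for a bijection
  of a finite set this is the usual orbit and contains \<open>x\<close>.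
\<close>

definition homomesic :: "'a set \<Rightarrow> ('a \<Rightarrow> 'a) \<Rightarrow> ('a \<Rightarrow> real) \<Rightarrow> bool" where
  "homomesic X T f \<longleftrightarrow> finite X \<and> bij_betw T X X \<and>
     (\<exists>c. \<forall>x\<in>X. (\<Sum>y\<in>orbit T x. f y) / real (card (orbit T x)) = c)"

lemma long_cycle_permutes:
  assumes "n > 0"
  shows "long_cycle n permutes {1..n}"
proof (rule bij_imp_permutes)
  have "inj_on (long_cycle n) {1..n}"
    by (auto simp: inj_on_def long_cycle_def split: if_splits)
  moreover have "long_cycle n ` {1..n} \<subseteq> {1..n}"
    using assms by (auto simp: long_cycle_def)
  ultimately show "bij_betw (long_cycle n) {1..n} {1..n}"
    by (simp add: bij_betw_def endo_inj_surj)
  show "long_cycle n x = x" if "x \<notin> {1..n}" for x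
    using that assms by (auto simp: long_cycle_def)
qed

lemma kreweras_in_sym_group:
  assumes "n > 0" "\<sigma> \<in> sym_group n"
  shows "kreweras n \<sigma> \<in> sym_group n" "kreweras_inv n \<sigma> \<in> sym_group n"
  using assms long_cycle_permutes[OF assms(1)]
  by (auto simp: sym_group_def kreweras_def kreweras_inv_def
      intro!: permutes_compose permutes_inv)

lemma kreweras_inverse:
  assumes "n > 0" "\<sigma> \<in> sym_group n"
  shows "kreweras_inv n (kreweras n \<sigma>) = \<sigma>" "kreweras n (kreweras_inv n \<sigma>) = \<sigma>"
proof -
  have c: "bij (long_cycle n)"
    using long_cycle_permutes[OF assms(1)] by (rule permutes_bij)
  have s: "bij \<sigma>"
    using assms(2) by (auto simp: sym_group_def intro: permutes_bij)
  note bijs = c s bij_imp_bij_inv[OF s]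
  show "kreweras_inv n (kreweras n \<sigma>) = \<sigma>"
    using bijs by (simp add: kreweras_def kreweras_inv_def o_inv_distrib inv_inv_eq
        comp_assoc bij_is_inj)
  have "long_cycle n \<circ> (inv (long_cycle n) \<circ> \<sigma>) = \<sigma>"
    using bij_is_surj[OF c] by (simp add: fun_eq_iff surj_f_inv_f)
  then show "kreweras n (kreweras_inv n \<sigma>) = \<sigma>"
    using bijs by (simp add: kreweras_def kreweras_inv_def o_inv_distrib inv_inv_eq)
qed

end

theory Submission
  imports Defs
begin

text \<open>
  Averages over an orbit are unchanged when \<open>f\<close> is replaced by \<open>f \<circ> T\<^sup>k\<close>, so homomesy follows as
  soon as the sum of \<open>f\<close> over \<open>p\<close> consecutive iterates is constant. For exceedances \<open>p = 2\<close> suffices,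
  since \<open>exc(K \<sigma>) + exc(\<sigma>) = n - 1\<close>. For the entry at \<open>m\<close> with \<open>n dvd 2 * m\<close> take \<open>p = 2 * n\<close>:
  as \<open>K\<^sup>2\<close> is conjugation by \<open>c\<close>, modulo \<open>n\<close> the even iterates take the values \<open>m - x + \<sigma> x\<close> and the
  odd ones the values \<open>m - y + 1 + \<sigma>\<^sup>-\<^sup>1 y\<close>, for \<open>x\<close> and \<open>y\<close> in \<open>{1..n}\<close>. For \<open>y = \<sigma> x\<close> the two add up
  to \<open>2 * m + 1\<close>, that is \<open>1\<close> modulo \<open>n\<close>, hence to exactly \<open>n + 1\<close>.
\<close>

section \<open>Homomesy from constant sums of consecutive iterates\<close>

lemma funpow_in:
  assumes "\<And>x. x \<in> X \<Longrightarrow> T x \<in> X" "x \<in> X"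
  shows "(T ^^ k) x \<in> X"
  using assms by (induction k) auto

lemma bij_betw_orbit:
  assumes "finite X" "bij_betw T X X" "x \<in> X"
  shows "orbit T x \<subseteq> X" "bij_betw T (orbit T x) (orbit T x)"
proof -
  have T: "T y \<in> X" if "y \<in> X" for y
    using assms(2) that by (auto simp: bij_betw_def)
  show sub: "orbit T x \<subseteq> X"
  proof
    fix y assume "y \<in> orbit T x"
    then show "y \<in> X" by induction (use T assms(3) in auto)
  qed
  have "finite (orbit T x)" using sub assms(1) finite_subset by blast
  moreover have "inj_on T (orbit T x)"
    using assms(2) sub by (auto simp: bij_betw_def intro: inj_on_subset)
  moreover have "T ` orbit T x \<subseteq> orbit T x" by (auto intro: orbit.step)
  ultimately show "bij_betw T (orbit T x) (orbit T x)"
    by (simp add: bij_betw_def endo_inj_surj)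
qed

text \<open>Double counting: each \<open>T ^^ k\<close> permutes the orbit, so summing the windows
  of length \<open>p\<close> over all starting points in the orbit counts every value of
  \<open>f\<close> exactly \<open>p\<close> times. The average on each orbit is therefore
  \<open>C / p\<close>.\<close>

lemma homomesic_if_constant_iterate_sums:
  fixes f :: "'a \<Rightarrow> real"
  assumes X: "finite X" "bij_betw T X X" and "p > 0"
    and sums: "\<And>x. x \<in> X \<Longrightarrow> (\<Sum>k<p. f ((T ^^ k) x)) = C"
  shows "homomesic X T f"
  unfolding homomesic_def
proof (intro conjI exI ballI)
  fix x assume x: "x \<in> X"
  let ?O = "orbit T x"
  note O = bij_betw_orbit[OF X x]
  have fin: "finite ?O" using O(1) X(1) finite_subset by blast
  have "T x \<in> ?O" by (rule orbit.base)
  then have card: "card ?O > 0" using fin card_gt_0_iff by blast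
  have "(\<Sum>y\<in>?O. f ((T ^^ k) y)) = (\<Sum>y\<in>?O. f y)" for k
    using sum.reindex_bij_betw[OF bij_betw_funpow[OF O(2)], of f k] .
  then have "real p * (\<Sum>y\<in>?O. f y) = (\<Sum>k<p. \<Sum>y\<in>?O. f ((T ^^ k) y))"
    by simp
  also have "\<dots> = (\<Sum>y\<in>?O. \<Sum>k<p. f ((T ^^ k) y))" by (rule sum.swap)
  also have "\<dots> = (\<Sum>y\<in>?O. C)" using sums O(1) by (intro sum.cong) auto
  finally have "real p * (\<Sum>y\<in>?O. f y) = real (card ?O) * C" by simp
  then show "(\<Sum>y\<in>?O. f y) / real (card ?O) = C / real p"
    using card \<open>p > 0\<close> by (simp add: field_simps)
qed (use X in auto)

text \<open>Read backwards, the first \<open>p\<close> iterates of \<open>S\<close> from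
  \<open>x\<close> are the first \<open>p\<close> iterates of \<open>T\<close> from
  \<open>(S ^^ (p - 1)) x\<close>, so both windows have the same sum.\<close>

lemma iterate_sums_of_inverse:
  fixes f :: "'a \<Rightarrow> real"
  assumes S: "\<And>x. x \<in> X \<Longrightarrow> S x \<in> X" and TS: "\<And>x. x \<in> X \<Longrightarrow> T (S x) = x"
    and sums: "\<And>x. x \<in> X \<Longrightarrow> (\<Sum>k<p. f ((T ^^ k) x)) = C" and x: "x \<in> X"
  shows "(\<Sum>k<p. f ((S ^^ k) x)) = C"
proof -
  have SX: "(S ^^ j) x \<in> X" for j
    by (rule funpow_in[OF S x])
  have T_S: "(T ^^ k) ((S ^^ (k + j)) x) = (S ^^ j) x" for k j
    by (induction k) (simp_all add: funpow_swap1[of T] TS SX)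
  have "(\<Sum>k<p. f ((S ^^ k) x)) = (\<Sum>k<p. f ((S ^^ (p - Suc k)) x))"
    by (rule sum.nat_diff_reindex[symmetric])
  also have "\<dots> = (\<Sum>k<p. f ((T ^^ k) ((S ^^ (p - 1)) x)))"
  proof (rule sum.cong[OF refl])
    fix k assume "k \<in> {..<p}"
    then have "p - 1 = k + (p - Suc k)" by auto
    then show "f ((S ^^ (p - Suc k)) x) = f ((T ^^ k) ((S ^^ (p - 1)) x))"
      by (metis T_S)
  qed
  also have "\<dots> = C" by (rule sums[OF SX])
  finally show ?thesis .
qed

text \<open>Leaves a single computation, with iterates of \<open>kreweras n\<close> only, for both
  directions.\<close>

lemma homomesic_kreweras:
  fixes f :: "(nat \<Rightarrow> nat) \<Rightarrow> real"
  assumes n: "n > 0" and "p > 0"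
    and sums: "\<And>\<sigma>. \<sigma> \<in> sym_group n \<Longrightarrow> (\<Sum>k<p. f ((kreweras n ^^ k) \<sigma>)) = C"
  shows "\<forall>T \<in> {kreweras n, kreweras_inv n}. homomesic (sym_group n) T f"
proof -
  note K = kreweras_in_sym_group[OF n] kreweras_inverse[OF n]
  have fin: "finite (sym_group n)"
    by (simp add: sym_group_def finite_permutations)
  have "bij_betw (kreweras n) (sym_group n) (sym_group n)"
    by (rule bij_betw_byWitness[where f' = "kreweras_inv n"]) (use K in auto)
  moreover have "bij_betw (kreweras_inv n) (sym_group n) (sym_group n)"
    by (rule bij_betw_byWitness[where f' = "kreweras n"]) (use K in auto)
  moreover have "(\<Sum>k<p. f ((kreweras_inv n ^^ k) \<sigma>)) = C" if "\<sigma> \<in> sym_group n" for \<sigma>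
    by (rule iterate_sums_of_inverse[where X = "sym_group n" and T = "kreweras n"])
      (use K sums that in auto)
  ultimately show ?thesis
    using homomesic_if_constant_iterate_sums[OF fin _ \<open>p > 0\<close>] sums by blast
qed

section \<open>Exceedances\<close>

lemma card_exceedances_add_card_weak_deficiencies:
  "card (exceedances n \<sigma>) + card (weak_deficiencies n \<sigma>) = n"
proof -
  have "exceedances n \<sigma> \<union> weak_deficiencies n \<sigma> = {1..n}"
    "exceedances n \<sigma> \<inter> weak_deficiencies n \<sigma> = {}"
    by (auto simp: exceedances_def weak_deficiencies_def)
  then show ?thesis
    using card_Un_disjoint[of "exceedances n \<sigma>" "weak_deficiencies n \<sigma>"]
    by (simp add: exceedances_def weak_deficiencies_def)
qed

text \<open>At the position \<open>\<sigma> j\<close> the complement has the entry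
  \<open>long_cycle n j\<close>. For \<open>j < n\<close> this is \<open>j + 1\<close>, which
  exceeds \<open>\<sigma> j\<close> iff \<open>j\<close> is a weak deficiency. For
  \<open>j = n\<close> it is 1, never an exceedance, although \<open>n\<close> is always a weak
  deficiency; this accounts for the 1.\<close>

lemma card_exceedances_kreweras:
  assumes n: "n > 0" and "\<sigma> \<in> sym_group n"
  shows "card (exceedances n (kreweras n \<sigma>)) + 1 = card (weak_deficiencies n \<sigma>)"
proof -
  have \<sigma>: "\<sigma> permutes {1..n}" using assms by (simp add: sym_group_def)
  have "exceedances n (kreweras n \<sigma>) = \<sigma> ` (weak_deficiencies n \<sigma> - {n})"
  proof (intro equalityI subsetI)
    fix i assume "i \<in> exceedances n (kreweras n \<sigma>)"
    then have i: "i \<in> {1..n}" "long_cycle n (inv \<sigma> i) > i"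
      by (auto simp: exceedances_def kreweras_def)
    have "inv \<sigma> i \<in> {1..n}" "\<sigma> (inv \<sigma> i) = i"
      using i(1) \<sigma> permutes_in_image[OF permutes_inv[OF \<sigma>]] permutes_inverses(1)[OF \<sigma>] by auto
    with i show "i \<in> \<sigma> ` (weak_deficiencies n \<sigma> - {n})"
      by (intro image_eqI[of _ _ "inv \<sigma> i"])
        (auto simp: weak_deficiencies_def long_cycle_def split: if_splits)
  next
    fix i assume "i \<in> \<sigma> ` (weak_deficiencies n \<sigma> - {n})"
    then obtain j where j: "i = \<sigma> j" "j \<in> {1..n}" "j \<noteq> n" "\<sigma> j \<le> j"
      by (auto simp: weak_deficiencies_def)
    then show "i \<in> exceedances n (kreweras n \<sigma>)"
      using permutes_in_image[OF \<sigma>, of j] permutes_inverses(2)[OF \<sigma>]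
      by (auto simp: exceedances_def kreweras_def long_cycle_def)
  qed
  moreover have "inj_on \<sigma> A" for A
    using permutes_inj[OF \<sigma>] inj_on_subset by blast
  moreover have "n \<in> weak_deficiencies n \<sigma>"
    using n permutes_in_image[OF \<sigma>, of n] by (auto simp: weak_deficiencies_def)
  moreover have "finite (weak_deficiencies n \<sigma>)"
    by (simp add: weak_deficiencies_def)
  ultimately show ?thesis
    by (simp add: card_image card_Suc_Diff1 del: card_Diff_insert card_Diff_singleton)
qed

section \<open>Entries\<close>

lemma permutes_funpow_in:
  assumes "\<pi> permutes A" "x \<in> A"
  shows "(\<pi> ^^ k) x \<in> A"
  using assms permutes_in_image by (intro funpow_in) fastforce+

lemma funpow_long_cycle_mod:
  assumes "n > 0" "x \<in> {1..n}"
  shows "int n dvd int ((long_cycle n ^^ k) x) - int x - int k"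
proof (induction k)
  case (Suc k)
  let ?y = "(long_cycle n ^^ k) x"
  have y: "?y \<in> {1..n}"
    by (rule permutes_funpow_in[OF long_cycle_permutes[OF assms(1)] assms(2)])
  \<comment> \<open>The difference is 0, except at the wrap-around \<open>?y = n\<close>, where it
    is \<open>- int n\<close>.\<close>
  have "int n dvd int (long_cycle n ?y) - int ?y - 1"
    using y by (auto simp: long_cycle_def)
  from dvd_add[OF this Suc] show ?case
    by (simp add: algebra_simps)
qed simp

text \<open>The square of the Kreweras complement is conjugation by the long cycle; evaluating at
  \<open>long_cycle n x\<close> keeps the inverse of the cycle out of the formula.\<close>

lemma kreweras_kreweras_long_cycle:
  assumes "n > 0" "\<sigma> \<in> sym_group n"
  shows "kreweras n (kreweras n \<sigma>) (long_cycle n x) = long_cycle n (\<sigma> x)"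
proof -
  have c: "bij (long_cycle n)"
    using long_cycle_permutes[OF assms(1)] by (rule permutes_bij)
  have s: "bij \<sigma>"
    using assms(2) by (auto simp: sym_group_def intro: permutes_bij)
  show ?thesis
    using c s bij_imp_bij_inv[OF s]
    by (simp add: kreweras_def o_inv_distrib inv_inv_eq bij_is_inj)
qed

lemma kreweras_even_iterate_long_cycle:
  assumes n: "n > 0" and \<sigma>: "\<sigma> \<in> sym_group n"
  shows "(kreweras n ^^ (2 * j)) \<sigma> ((long_cycle n ^^ j) x) = (long_cycle n ^^ j) (\<sigma> x)"
proof (induction j)
  case (Suc j)
  have "(kreweras n ^^ (2 * j)) \<sigma> \<in> sym_group n"
    by (rule funpow_in[OF kreweras_in_sym_group(1)[OF n] \<sigma>])
  then show ?case
    using Suc kreweras_kreweras_long_cycle[OF n] by simp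
qed simp

lemma int_eq_if_dvd_diff:
  assumes "x \<in> {1..n}" "y \<in> {1..n}" "int n dvd int x - int y"
  shows "x = y"
proof -
  have "\<bar>int x - int y\<bar> < int n" using assms(1,2) by auto
  then show ?thesis using assms(3) zdvd_imp_le[of "int n" "\<bar>int x - int y\<bar>"] by force
qed

lemma sum_entries_kreweras_iterates:
  assumes n: "n > 0" and \<sigma>: "\<sigma> \<in> sym_group n" and m: "m \<in> {1..n}" "n dvd 2 * m"
  shows "(\<Sum>k<2 * n. (kreweras n ^^ k) \<sigma> m) = n * (n + 1)"
proof -
  let ?c = "long_cycle n" and ?K = "kreweras n"
  have perm: "\<sigma> permutes {1..n}" using \<sigma> by (simp add: sym_group_def)
  note c = permutes_funpow_in[OF long_cycle_permutes[OF n]]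
  \<comment> \<open>\<open>ix x\<close> is the number of cycle steps, less than \<open>n\<close>,
    that lead from \<open>x\<close> to \<open>m\<close>. Indexing the iterates by \<open>x\<close>
    instead of \<open>j = ix x\<close> makes their entries at \<open>m\<close> computable from
    \<open>\<sigma> x\<close>.\<close>
  define ix where "ix x = nat ((int m - int x) mod int n)" for x
  have ix_int: "int (ix x) = (int m - int x) mod int n" for x
    using n by (simp add: ix_def)
  have ix_dvd: "int n dvd int m - int x - int (ix x)" for x
    by (simp add: ix_int)
  have c_ix: "(?c ^^ ix x) x = m" if "x \<in> {1..n}" for x
  proof (rule int_eq_if_dvd_diff[OF c[OF that] m(1)])
    show "int n dvd int ((?c ^^ ix x) x) - int m"
      using dvd_diff[OF funpow_long_cycle_mod[OF n that, of "ix x"] ix_dvd[of x]]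
      by (simp add: algebra_simps)
  qed
  have ix_bij: "bij_betw ix {1..n} {..<n}"
  proof -
    have "inj_on ix {1..n}"
    proof (rule inj_onI)
      fix x y assume xy: "x \<in> {1..n}" "y \<in> {1..n}" "ix x = ix y"
      show "x = y"
        by (rule int_eq_if_dvd_diff[OF xy(1,2)])
          (use dvd_diff[OF ix_dvd[of y] ix_dvd[of x]] xy(3) in simp)
    qed
    moreover have "ix ` {1..n} \<subseteq> {..<n}"
      using n by (auto simp: ix_def nat_less_iff)
    ultimately show ?thesis
      by (simp add: bij_betw_def card_image card_subset_eq)
  qed
  define a where "a j = (?K ^^ (2 * j)) \<sigma> m" for j
  define b where "b j = (?K ^^ (2 * j + 1)) \<sigma> m" for j
  have pair: "a (ix x) + b (ix (\<sigma> x)) = n + 1" if x: "x \<in> {1..n}" for x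
  proof -
    have \<sigma>x: "\<sigma> x \<in> {1..n}" using x permutes_in_image[OF perm] by blast
    have cx: "?c x \<in> {1..n}" using c[OF x, of 1] by simp
    have a: "a (ix x) = (?c ^^ ix x) (\<sigma> x)"
      using kreweras_even_iterate_long_cycle[OF n \<sigma>, of "ix x" x] c_ix[OF x]
      by (simp add: a_def)
    \<comment> \<open>Odd iterates of \<open>\<sigma>\<close> are even iterates of
      \<open>?K \<sigma>\<close>, which sends \<open>\<sigma> x\<close> to
      \<open>?c x\<close>.\<close>
    have "b (ix (\<sigma> x)) = (?K ^^ (2 * ix (\<sigma> x))) (?K \<sigma>) ((?c ^^ ix (\<sigma> x)) (\<sigma> x))"
      using c_ix[OF \<sigma>x] by (simp add: b_def funpow_swap1)
    also have "\<dots> = (?c ^^ ix (\<sigma> x)) (?K \<sigma> (\<sigma> x))"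
      by (rule kreweras_even_iterate_long_cycle[OF n kreweras_in_sym_group(1)[OF n \<sigma>]])
    finally have b: "b (ix (\<sigma> x)) = (?c ^^ ix (\<sigma> x)) (?c x)"
      using permutes_inverses(2)[OF perm] by (simp add: kreweras_def)
    have range: "a (ix x) \<in> {1..n}" "b (ix (\<sigma> x)) \<in> {1..n}"
      unfolding a b using c[OF \<sigma>x] c[OF cx] by blast+
    have "int n dvd int (a (ix x)) - int (\<sigma> x) - int (ix x)"
      unfolding a by (rule funpow_long_cycle_mod[OF n \<sigma>x])
    moreover have "int n dvd int (b (ix (\<sigma> x))) - int (?c x) - int (ix (\<sigma> x))"
      unfolding b by (rule funpow_long_cycle_mod[OF n cx])
    moreover have "int n dvd int (?c x) - int x - 1"
      using funpow_long_cycle_mod[OF n x, of 1] by simp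
    moreover have "int n dvd 2 * int m"
      using m(2) by (metis int_dvd_int_iff of_nat_mult of_nat_numeral)
    \<comment> \<open>All terms in \<open>x\<close>, \<open>\<sigma> x\<close>, \<open>?c x\<close>
      and \<open>ix\<close> cancel, as does \<open>2 * int m\<close> against the two copies of
      \<open>m\<close> that come from \<open>ix_dvd\<close>.\<close>
    ultimately have "int n dvd (int (a (ix x)) - int (\<sigma> x) - int (ix x))
        + (int (b (ix (\<sigma> x))) - int (?c x) - int (ix (\<sigma> x))) + (int (?c x) - int x - 1)
        + 2 * int m - (int m - int x - int (ix x)) - (int m - int (\<sigma> x) - int (ix (\<sigma> x)))"
      by (intro dvd_diff[OF _ ix_dvd] dvd_add)
    then have "int n dvd int (a (ix x)) + int (b (ix (\<sigma> x))) - 1"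
      by (simp add: algebra_simps)
    then obtain q where q: "int (a (ix x)) + int (b (ix (\<sigma> x))) - 1 = int n * q" ..
    \<comment> \<open>Both entries lie in \<open>{1..n}\<close>, so their sum minus 1 lies strictly
      between 0 and \<open>2 * n\<close>; the only multiple of \<open>n\<close> there is
      \<open>n\<close>.\<close>
    have "int n * q > int n * 0" "int n * q < int n * 2"
      using range unfolding q[symmetric] by auto
    then have "q = 1" using n by (simp only: mult_less_cancel_left) auto
    with q show ?thesis by simp
  qed
  have "(\<Sum>k<2 * n. (?K ^^ k) \<sigma> m) = (\<Sum>j<n. a j) + (\<Sum>j<n. b j)"
  proof -
    have "(\<Sum>k<2 * i. (?K ^^ k) \<sigma> m) = (\<Sum>j<i. a j) + (\<Sum>j<i. b j)" for i
      by (induction i) (simp_all add: a_def b_def)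
    then show ?thesis .
  qed
  also have "(\<Sum>j<n. a j) = (\<Sum>x=1..n. a (ix x))"
    by (rule sum.reindex_bij_betw[OF ix_bij, symmetric])
  also have "(\<Sum>j<n. b j) = (\<Sum>y=1..n. b (ix y))"
    by (rule sum.reindex_bij_betw[OF ix_bij, symmetric])
  \<comment> \<open>Reordering the odd iterates by \<open>\<sigma>\<close> puts each one next to its
    partner in \<open>pair\<close>.\<close>
  also have "\<dots> = (\<Sum>x=1..n. b (ix (\<sigma> x)))"
    by (rule sum.reindex_bij_betw[OF permutes_imp_bij[OF perm], symmetric])
  also have "(\<Sum>x=1..n. a (ix x)) + \<dots> = (\<Sum>x=1..n. n + 1)"
    unfolding sum.distrib[symmetric] using pair by (intro sum.cong) auto
  finally show ?thesis by simp
qed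

theorem theorem7p3:
  fixes n :: nat
  assumes "n > 0"
  shows "\<forall>T \<in> {kreweras n, kreweras_inv n}.
      homomesic (sym_group n) T (\<lambda>\<sigma>. real (card (exceedances n \<sigma>))) \<and>
      homomesic (sym_group n) T (\<lambda>\<sigma>. real (card (weak_deficiencies n \<sigma>))) \<and>
      homomesic (sym_group n) T (\<lambda>\<sigma>. real (\<sigma> n)) \<and>
      (even n \<longrightarrow> homomesic (sym_group n) T (\<lambda>\<sigma>. real (\<sigma> (n div 2))))"
proof -
  have exc: "real (card (exceedances n \<sigma>)) + real (card (exceedances n (kreweras n \<sigma>))) = real n - 1"
    if "\<sigma> \<in> sym_group n" for \<sigma>
    using card_exceedances_kreweras[OF assms that]
      card_exceedances_add_card_weak_deficiencies[of n \<sigma>] by linarith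
  have wdef: "real (card (weak_deficiencies n \<sigma>)) = real n - real (card (exceedances n \<sigma>))" for \<sigma>
    using card_exceedances_add_card_weak_deficiencies[of n \<sigma>] by linarith
  have "\<forall>T \<in> {kreweras n, kreweras_inv n}.
      homomesic (sym_group n) T (\<lambda>\<sigma>. real (card (exceedances n \<sigma>)))"
    by (rule homomesic_kreweras[OF assms, of 2 _ "real n - 1"])
      (simp_all add: numeral_2_eq_2 exc)
  moreover have "\<forall>T \<in> {kreweras n, kreweras_inv n}.
      homomesic (sym_group n) T (\<lambda>\<sigma>. real (card (weak_deficiencies n \<sigma>)))"
  \<comment> \<open>The constant is \<open>2 * n - (n - 1)\<close>, the complement of the one for
    exceedances.\<close>
  proof (rule homomesic_kreweras[OF assms, of 2 _ "real n + 1"])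
    fix \<sigma> assume "\<sigma> \<in> sym_group n"
    from exc[OF this]
    show "(\<Sum>k<2. real (card (weak_deficiencies n ((kreweras n ^^ k) \<sigma>)))) = real n + 1"
      by (simp add: numeral_2_eq_2 wdef)
  qed simp
  \<comment> \<open>The positions allowed here are \<open>n\<close> and, for even \<open>n\<close>,
    \<open>n div 2\<close>. The average is \<open>(n + 1) / 2\<close> in both cases.\<close>
  moreover have entry: "\<forall>T \<in> {kreweras n, kreweras_inv n}.
      homomesic (sym_group n) T (\<lambda>\<sigma>. real (\<sigma> m))" if "m \<in> {1..n}" "n dvd 2 * m" for m
  proof (rule homomesic_kreweras[OF assms, of "2 * n" _ "real (n * (n + 1))"])
    fix \<sigma> assume "\<sigma> \<in> sym_group n"
    from sum_entries_kreweras_iterates[OF assms this that]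
    show "(\<Sum>k<2 * n. real ((kreweras n ^^ k) \<sigma> m)) = real (n * (n + 1))"
      by (simp only: of_nat_sum[symmetric])
  qed (use assms in simp)
  moreover have "n div 2 \<in> {1..n}" "n dvd 2 * (n div 2)" if "even n"
    using that assms by (auto elim!: evenE)
  ultimately show ?thesis
    using entry[of n] entry[of "n div 2"] assms by simp
qed

end
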